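(* Let $U = U(x,y)$ be a word in $x$ and $y$. Then every (nonempty) semigroup that satisfies the identity $y \sim x\,U(x,y)\,x$ is a group.
   Context: A semigroup is a set with an associative binary operation. A word in $x$ and $y$ is a finite string of $x$s and $y$s. An identity $W_1(x,y)\sim W_2(x,y)$ consists of two words $W_1,W_2$ in $x$ and $y$. A semigroup $S$ satisfies this identity (is a model of it) if $W_1(s,t)=W_2(s,t)$ in $S$ for all $s,t\in S$, where $W_i(s,t)$ is the product obtained by replacing $x$ by $s$ and $y$ by $t$. *)

theory Defs
  imports "HOL-Algebra.Group"
begin

definition semigroup_on :: "'a set \<Rightarrow> ('a \<Rightarrow> 'a \<Rightarrow> 'a) \<Rightarrow> bool" where
  "semigroup_on S f \<longleftrightarrow>
     (\<forall>a\<in>S. \<forall>b\<in>S. f a b \<in> S) \<and>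
     (\<forall>a\<in>S. \<forall>b\<in>S. \<forall>c\<in>S. f (f a b) c = f a (f b c))"

datatype letter = Var_x | Var_y

type_synonym word = "letter list"

primrec subst_letter :: "'a \<Rightarrow> 'a \<Rightarrow> letter \<Rightarrow> 'a" where
  "subst_letter s t Var_x = s"
| "subst_letter s t Var_y = t"

text \<open>A semigroup need not have a neutral element, so the empty word has no value in it;
  the equation for the empty list only makes the function total.\<close>

fun word_value :: "('a \<Rightarrow> 'a \<Rightarrow> 'a) \<Rightarrow> word \<Rightarrow> 'a \<Rightarrow> 'a \<Rightarrow> 'a" where
  "word_value f [] s t = undefined"
| "word_value f [c] s t = subst_letter s t c"
| "word_value f (c # d # w) s t = f (subst_letter s t c) (word_value f (d # w) s t)"

text \<open>Intended for nonempty words only.\<close>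

definition satisfies_identity ::
  "'a set \<Rightarrow> ('a \<Rightarrow> 'a \<Rightarrow> 'a) \<Rightarrow> word \<Rightarrow> word \<Rightarrow> bool" where
  "satisfies_identity S f W1 W2 \<longleftrightarrow>
     (\<forall>s\<in>S. \<forall>t\<in>S. word_value f W1 s t = word_value f W2 s t)"

text \<open>The library's groups carry their neutral element as a record field,
  whereas here only the set and the operation are given.\<close>

definition group_on :: "'a set \<Rightarrow> ('a \<Rightarrow> 'a \<Rightarrow> 'a) \<Rightarrow> bool" where
  "group_on S f \<longleftrightarrow> (\<exists>e. group \<lparr>carrier = S, monoid.mult = f, one = e\<rparr>)"

end

theory Submission
  imports Defs
begin

text \<open>The word \<open>x U(x,y) x\<close> begins and ends with \<open>x\<close> and has length at least two, whatever
  \<open>U\<close> is. Peeling off the first or the last letter therefore writes any \<open>t\<close> both as \<open>s z\<close> and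
  as \<open>w s\<close>, for any \<open>s\<close>: all equations \<open>s z = t\<close> and \<open>w s = t\<close> are solvable in the semigroup.
  A nonempty semigroup with this property is a group (\<open>group_on_if_divisible\<close>).\<close>

lemma word_value_closed:
  assumes "semigroup_on S f" "s \<in> S" "t \<in> S" "w \<noteq> []"
  shows "word_value f w s t \<in> S"
proof -
  have letter: "subst_letter s t c \<in> S" for c
    using assms by (cases c) auto
  show ?thesis
    using \<open>w \<noteq> []\<close> letter assms(1)
    by (induction f w s t rule: word_value.induct) (auto simp: semigroup_on_def)
qed

text \<open>Words are evaluated with brackets to the right, so splitting off the first letter holds
  by definition, but splitting off the last one takes associativity.\<close>

lemma word_value_snoc:
  assumes "semigroup_on S f" "s \<in> S" "t \<in> S" "w \<noteq> []"
  shows "word_value f (w @ [c]) s t = f (word_value f w s t) (subst_letter s t c)"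
  using \<open>w \<noteq> []\<close>
proof (induction w rule: list_nonempty_induct)
  case (single d)
  show ?case by simp
next
  case (cons d w)
  have letter: "subst_letter s t b \<in> S" for b
    using assms by (cases b) auto
  have "word_value f w s t \<in> S"
    using assms(1-3) cons.hyps by (rule word_value_closed)
  moreover have "word_value f ((d # w) @ [c]) s t
      = f (subst_letter s t d) (word_value f (w @ [c]) s t)"
    using cons.hyps by (cases w) auto
  moreover have "word_value f (d # w) s t = f (subst_letter s t d) (word_value f w s t)"
    using cons.hyps by (cases w) auto
  ultimately show ?case
    using assms(1) letter cons.IH by (simp add: semigroup_on_def)
qed

text \<open>Fix \<open>a\<close>. A solution of \<open>a e = a\<close> is a right identity for every \<open>b\<close>, because \<open>b\<close> has the
  form \<open>w a\<close>; dually, a solution of \<open>e' a = a\<close> is a left identity. Hence \<open>e' = e' e = e\<close>, and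
  solving \<open>w b = e\<close> yields left inverses.\<close>

lemma group_on_if_divisible:
  assumes "semigroup_on S f" "S \<noteq> {}"
    and right: "\<And>s t. s \<in> S \<Longrightarrow> t \<in> S \<Longrightarrow> \<exists>z\<in>S. f s z = t"
    and left: "\<And>s t. s \<in> S \<Longrightarrow> t \<in> S \<Longrightarrow> \<exists>w\<in>S. f w s = t"
  shows "group_on S f"
proof -
  have closed: "f a b \<in> S" if "a \<in> S" "b \<in> S" for a b
    using assms(1) that by (simp add: semigroup_on_def)
  have assoc: "f (f a b) c = f a (f b c)" if "a \<in> S" "b \<in> S" "c \<in> S" for a b c
    using assms(1) that by (simp add: semigroup_on_def)
  obtain a where a: "a \<in> S"
    using \<open>S \<noteq> {}\<close> by blast
  obtain e where e: "e \<in> S" "f a e = a"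
    using right[OF a a] by blast
  obtain e' where e': "e' \<in> S" "f e' a = a"
    using left[OF a a] by blast
  have e_right: "f b e = b" if b: "b \<in> S" for b
  proof -
    obtain w where "w \<in> S" "f w a = b"
      using left[OF a b] by blast
    then show ?thesis
      using assoc[of w a e] a e by simp
  qed
  have e'_left: "f e' b = b" if b: "b \<in> S" for b
  proof -
    obtain z where "z \<in> S" "f a z = b"
      using right[OF a b] by blast
    then show ?thesis
      using assoc[of e' a z] a e' by simp
  qed
  have "e' = e"
    using e_right[of e'] e'_left[of e] e e' by simp
  then have e_left: "f e b = b" if "b \<in> S" for b
    using e'_left that by simp
  have "group \<lparr>carrier = S, monoid.mult = f, one = e\<rparr>"
  proof (rule groupI)
    fix b assume "b \<in> carrier \<lparr>carrier = S, monoid.mult = f, one = e\<rparr>"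
    then show "\<exists>w\<in>carrier \<lparr>carrier = S, monoid.mult = f, one = e\<rparr>.
        w \<otimes>\<^bsub>\<lparr>carrier = S, monoid.mult = f, one = e\<rparr>\<^esub> b
          = \<one>\<^bsub>\<lparr>carrier = S, monoid.mult = f, one = e\<rparr>\<^esub>"
      using left[of b e] e by simp
  qed (simp_all add: closed assoc e(1) e_left)
  then show ?thesis
    unfolding group_on_def by blast
qed

theorem mainTheorem1:
  fixes U :: word and S :: "'a set" and f :: "'a \<Rightarrow> 'a \<Rightarrow> 'a"
  assumes "semigroup_on S f"
    and "S \<noteq> {}"
    and "satisfies_identity S f [Var_y] ([Var_x] @ U @ [Var_x])"
  shows "group_on S f"
proof (rule group_on_if_divisible[OF assms(1,2)])
  fix s t assume st: "s \<in> S" "t \<in> S"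
  have value_eq: "word_value f ([Var_x] @ U @ [Var_x]) s t = t"
  proof -
    have "word_value f [Var_y] s t = word_value f ([Var_x] @ U @ [Var_x]) s t"
      using assms(3) st unfolding satisfies_identity_def by blast
    then show ?thesis by simp
  qed
  have "f s (word_value f (U @ [Var_x]) s t) = t"
    using value_eq by (cases U) auto
  moreover have "word_value f (U @ [Var_x]) s t \<in> S"
    using assms(1) st by (rule word_value_closed) simp
  ultimately show "\<exists>z\<in>S. f s z = t"
    by blast
  have "f (word_value f ([Var_x] @ U) s t) s = t"
    using value_eq word_value_snoc[OF assms(1) st, of "[Var_x] @ U" Var_x] by simp
  moreover have "word_value f ([Var_x] @ U) s t \<in> S"
    using assms(1) st by (rule word_value_closed) simp
  ultimately show "\<exists>w\<in>S. f w s = t"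
    by blast
qed

end
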